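(* For any $p\in[1,\infty)$ with conjugate index $q$ (i.e. $\frac1p+\frac1q=1$), the dual operator of the forward Collatz-Koopman operator $L_{T,p}\colon\ell_p\to\ell_p$ is the backward Collatz-Koopman operator on $\ell_q$: $L_{T,p}^*=B_{T,q}$. In particular $L_{T,2}^*=B_{T,2}$. Moreover $\|B_{T,p}\|=2^{\frac1p}$ for every $p\in[1,\infty]$ (with $2^{1/\infty}=1$).
   Context: $\mathbb{N}^*=\{1,2,3,\dots\}$. The Collatz map $T\colon\mathbb{N}^*\to\mathbb{N}^*$ is $T(n)=n/2$ for $n$ even and $T(n)=(3n+1)/2$ for $n$ odd. $\ell_p$ is the usual Banach space of scalar sequences indexed by $\mathbb{N}^*$, and $\ell_p^*$ is identified with $\ell_q$ through $\langle x,y\rangle=\sum_n x_ny_n$. The forward operator $L_{T,p}\colon\ell_p\to\ell_p$ sends $x$ to the sequence with $m$-th coordinate $\sum_{n:\,T(n)=m}x_n$ (so $L_{T,p}(e_n)=e_{T(n)}$). The backward operator $B_{T,p}\colon\ell_p\to\ell_p$, $1\le p\le\infty$, is $B_{T,p}((x_n))=(a_n)$ with $a_{6k}=x_{3k}$ for $k\ge1$, and $a_{6k+2}=x_{3k+1}$, $a_{6k+4}=a_{2k+1}=x_{3k+2}$ for $k\ge0$ (equivalently $a_n=x_{T(n)}$). *)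

theory Defs
  imports "HOL-Analysis.Analysis"
begin

section \<open>The sequence spaces\<close>

text \<open>
  Sequences indexed by the positive integers are functions on \<^typ>\<open>nat\<close> that vanish at 0, so the
  index 0 contributes nothing to the series below. The exponent ranges over the extended
  nonnegative reals, where \<^term>\<open>1 / \<infinity> = (0 :: ennreal)\<close>. The scalars form a complete normed
  field, which covers both the real and the complex case.
\<close>

definition lp :: "ennreal \<Rightarrow> (nat \<Rightarrow> 'a::{real_normed_field,banach}) set" where
  "lp p = {x. x 0 = 0 \<and>
     (if p = \<infinity> then bounded (range x) else summable (\<lambda>n. norm (x n) powr enn2real p))}"

definition lp_norm :: "ennreal \<Rightarrow> (nat \<Rightarrow> 'a::{real_normed_field,banach}) \<Rightarrow> real" where
  "lp_norm p x = (if p = \<infinity> then (SUP n. norm (x n))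
     else (\<Sum>n. norm (x n) powr enn2real p) powr (1 / enn2real p))"

definition lp_bounded_operator ::
    "ennreal \<Rightarrow> ((nat \<Rightarrow> 'a::{real_normed_field,banach}) \<Rightarrow> (nat \<Rightarrow> 'a)) \<Rightarrow> bool" where
  "lp_bounded_operator p F \<longleftrightarrow>
     (\<forall>x\<in>lp p. F x \<in> lp p) \<and>
     (\<forall>x\<in>lp p. \<forall>y\<in>lp p. F (\<lambda>n. x n + y n) = (\<lambda>n. F x n + F y n)) \<and>
     (\<forall>c. \<forall>x\<in>lp p. F (\<lambda>n. c * x n) = (\<lambda>n. c * F x n)) \<and>
     (\<exists>C. \<forall>x\<in>lp p. lp_norm p (F x) \<le> C * lp_norm p x)"

definition lp_onorm ::
    "ennreal \<Rightarrow> ((nat \<Rightarrow> 'a::{real_normed_field,banach}) \<Rightarrow> (nat \<Rightarrow> 'a)) \<Rightarrow> real" where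
  "lp_onorm p F = (SUP x\<in>{x \<in> lp p. lp_norm p x \<le> 1}. lp_norm p (F x))"

section \<open>Duality\<close>

text \<open>
  Functionals are extensional: undefined outside \<^term>\<open>lp p\<close>, so that equality of functionals is
  equality on \<^term>\<open>lp p\<close>.
\<close>

definition lp_dual :: "ennreal \<Rightarrow> ((nat \<Rightarrow> 'a::{real_normed_field,banach}) \<Rightarrow> 'a) set" where
  "lp_dual p = {\<phi> \<in> extensional (lp p).
     (\<forall>x\<in>lp p. \<forall>y\<in>lp p. \<phi> (\<lambda>n. x n + y n) = \<phi> x + \<phi> y) \<and>
     (\<forall>c. \<forall>x\<in>lp p. \<phi> (\<lambda>n. c * x n) = c * \<phi> x) \<and>
     (\<exists>C. \<forall>x\<in>lp p. norm (\<phi> x) \<le> C * lp_norm p x)}"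

definition lp_pairing ::
    "ennreal \<Rightarrow> (nat \<Rightarrow> 'a::{real_normed_field,banach}) \<Rightarrow> (nat \<Rightarrow> 'a) \<Rightarrow> 'a" where
  "lp_pairing p y = (\<lambda>x\<in>lp p. \<Sum>n. x n * y n)"

text \<open>
  The dual operator of \<^term>\<open>F\<close> sends a functional \<open>\<phi>\<close> on \<^term>\<open>lp p\<close> to \<open>\<phi> \<circ> F\<close>
  (\<^const>\<open>compose\<close> is composition restricted to \<^term>\<open>lp p\<close>). It is transported to an operator on
  \<^term>\<open>lp q\<close> along the bijection \<^term>\<open>lp_pairing p\<close> between \<^term>\<open>lp q\<close> and \<^term>\<open>lp_dual p\<close>
  established in \<open>bij_betw_lp_pairing\<close> below.
\<close>

definition lp_dual_operator ::
    "ennreal \<Rightarrow> ennreal \<Rightarrow> ((nat \<Rightarrow> 'a::{real_normed_field,banach}) \<Rightarrow> (nat \<Rightarrow> 'a))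
      \<Rightarrow> (nat \<Rightarrow> 'a) \<Rightarrow> (nat \<Rightarrow> 'a)" where
  "lp_dual_operator p q F y =
     the_inv_into (lp q) (lp_pairing p) (compose (lp p) (lp_pairing p y) F)"

section \<open>The Collatz operators\<close>

text \<open>Only the values at positive arguments matter.\<close>

definition collatz :: "nat \<Rightarrow> nat" where
  "collatz n = (if even n then n div 2 else (3 * n + 1) div 2)"

text \<open>
  The formulas for both operators do not involve the exponent; it enters only through the space
  \<^term>\<open>lp p\<close> on which they act. Fibres of \<^const>\<open>collatz\<close> are finite, so the sum is a finite one.
\<close>

definition collatz_forward :: "(nat \<Rightarrow> 'a::comm_monoid_add) \<Rightarrow> nat \<Rightarrow> 'a" where
  "collatz_forward x m = (\<Sum>n | n \<ge> 1 \<and> collatz n = m. x n)"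

definition collatz_backward :: "(nat \<Rightarrow> 'a) \<Rightarrow> nat \<Rightarrow> 'a" where
  "collatz_backward x n =
     (if odd n then x (3 * (n div 2) + 2)
      else if n mod 6 = 0 then x (3 * (n div 6))
      else if n mod 6 = 2 then x (3 * (n div 6) + 1)
      else x (3 * (n div 6) + 2))"

lemma finite_collatz_fibre: "finite {n. n \<ge> 1 \<and> collatz n = m}"
proof (rule finite_subset)
  show "{n. n \<ge> 1 \<and> collatz n = m} \<subseteq> {..2 * m}"
    by (auto simp: collatz_def split: if_splits)
qed simp

lemma collatz_backward_eq: "collatz_backward x n = x (collatz n)"
proof (cases "odd n")
  case True
  then have "3 * (n div 2) + 2 = (3 * n + 1) div 2"
    by (elim oddE) simp
  with True show ?thesis
    by (simp add: collatz_backward_def collatz_def)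
next
  case False
  then have "n mod 6 = 0 \<or> n mod 6 = 2 \<or> n mod 6 = 4"
    by presburger
  moreover have "n div 2 = 3 * (n div 6) + (n mod 6) div 2"
    using False by presburger
  ultimately show ?thesis
    using False by (auto simp: collatz_backward_def collatz_def)
qed

section \<open>The dual of \<open>\<ell>\<^sub>p\<close>\<close>

lemma lp_infinity_norm_le: "x \<in> lp \<infinity> \<Longrightarrow> norm (x n) \<le> lp_norm \<infinity> x"
proof -
  assume "x \<in> lp \<infinity>"
  then have "bdd_above (range (\<lambda>n. norm (x n)))"
    by (auto simp: lp_def bounded_iff bdd_above_def)
  then have "norm (x n) \<le> (SUP n. norm (x n))"
    by (rule cSUP_upper[OF UNIV_I])
  then show ?thesis
    by (simp add: lp_norm_def)
qed

lemma conjugate_cases: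
  assumes "1 \<le> p" "p < \<infinity>" "1 / p + 1 / q = (1::ennreal)"
  obtains "p = 1" "q = \<infinity>"
  | r s where "p = ennreal r" "q = ennreal s" "1 < r" "1 < s" "1 / r + 1 / s = 1"
proof (cases "p = 1")
  case True
  then have "1 + 1 / q = (1 + 0 ::ennreal)"
    using assms by simp
  then have "1 / q = 0"
    by (simp only: ennreal_add_left_cancel) auto
  then have "q = \<infinity>"
    by (simp add: divide_ennreal_def)
  then show thesis
    using True that by blast
next
  case False
  obtain r where r: "p = ennreal r" "0 \<le> r"
    using assms(2) by (cases p) auto
  have "1 \<le> r"
    using assms(1) r by simp
  then have r1: "1 < r"
    using False r by (cases "r = 1") auto
  have ip: "1 / p = ennreal (1 / r)"
    using r r1 by (simp add: divide_ennreal flip: ennreal_1)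
  have "q \<noteq> \<infinity>"
    using assms(3) ip r1 by (auto simp flip: ennreal_1)
  then obtain s where s: "q = ennreal s" "0 \<le> s"
    by (cases q) auto
  have "s \<noteq> 0"
    using assms(3) s by (auto simp: divide_ennreal_def)
  then have s0: "s > 0"
    using s by simp
  have "1 / q = ennreal (1 / s)"
    using s s0 by (simp add: divide_ennreal flip: ennreal_1)
  then have "ennreal (1 / r + 1 / s) = ennreal 1"
    using assms(3) ip r1 s0 by (simp add: ennreal_plus)
  then have rs: "1 / r + 1 / s = 1"
    using r1 s0 by (subst (asm) ennreal_inj) auto
  moreover have "1 < s"
  proof -
    have "1 / s < 1"
      using rs r1 by (smt (verit) divide_pos_pos)
    then show ?thesis
      using s0 by simp
  qed
  ultimately show thesis
    using that r s r1 by blast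
qed

lemma lp_holder_real:
  fixes x y :: "nat \<Rightarrow> 'a::{real_normed_field,banach}"
  assumes rs: "1 < r" "1 < s" "1 / r + 1 / s = 1"
    and x: "summable (\<lambda>n. norm (x n) powr r)" and y: "summable (\<lambda>n. norm (y n) powr s)"
  defines "X \<equiv> (\<Sum>n. norm (x n) powr r) powr (1 / r)"
    and "Y \<equiv> (\<Sum>n. norm (y n) powr s) powr (1 / s)"
  shows "summable (\<lambda>n. norm (x n * y n)) \<and> (\<Sum>n. norm (x n * y n)) \<le> X * Y"
proof (cases "X = 0 \<or> Y = 0")
  case True
  have *: "z n = 0" if "summable (\<lambda>n. norm (z n) powr t)" "(\<Sum>n. norm (z n) powr t) powr (1 / t) = 0"
    for z :: "nat \<Rightarrow> 'a" and t n
    using that by (subst (asm) powr_eq_0_iff, subst (asm) suminf_eq_zero_iff) auto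
  have "x n * y n = 0" for n
    using True *[OF x, of n] *[OF y, of n] unfolding X_def Y_def by auto
  then have "(\<lambda>n. norm (x n * y n)) = (\<lambda>n. 0)"
    by (intro ext) simp
  then show ?thesis
    unfolding X_def Y_def by simp
next
  case False
  have SX: "0 \<le> (\<Sum>n. norm (x n) powr r)" and SY: "0 \<le> (\<Sum>n. norm (y n) powr s)"
    using x y by (auto intro!: suminf_nonneg)
  have pos: "0 < X" "0 < Y"
    using False unfolding X_def Y_def by auto
  have Xr: "X powr r = (\<Sum>n. norm (x n) powr r)" and Ys: "Y powr s = (\<Sum>n. norm (y n) powr s)"
    using rs SX SY unfolding X_def Y_def by (auto simp: powr_powr)
  have le: "norm (x n * y n) \<le> X * Y * (norm (x n) powr r / X powr r / r + norm (y n) powr s / Y powr s / s)"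
    for n
  proof -
    have "norm (x n) / X * (norm (y n) / Y) \<le> (norm (x n) / X) powr r / r + (norm (y n) / Y) powr s / s"
      using rs pos by (intro Youngs_inequality) auto
    then show ?thesis
      using pos by (simp add: powr_divide norm_mult field_simps)
  qed
  have sm: "(\<lambda>n. X * Y * (norm (x n) powr r / X powr r / r + norm (y n) powr s / Y powr s / s))
      sums (X * Y * (X powr r / X powr r / r + Y powr s / Y powr s / s))"
    unfolding Xr Ys by (intro sums_mult sums_add sums_divide summable_sums x y)
  have eq: "X * Y * (X powr r / X powr r / r + Y powr s / Y powr s / s) = X * Y"
    using pos rs by simp
  have "summable (\<lambda>n. norm (x n * y n))"
    by (rule summable_comparison_test'[OF sums_summable[OF sm], of 0]) (use le in simp)
  moreover have "(\<Sum>n. norm (x n * y n)) \<le> X * Y"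
    using suminf_le[OF le calculation sums_summable[OF sm]] sums_unique[OF sm] eq by simp
  ultimately show ?thesis
    by blast
qed

lemma lp_holder:
  fixes x y :: "nat \<Rightarrow> 'a::{real_normed_field,banach}"
  assumes "1 \<le> p" "p < \<infinity>" "1 / p + 1 / q = 1" and x: "x \<in> lp p" and y: "y \<in> lp q"
  shows "summable (\<lambda>n. norm (x n * y n)) \<and> (\<Sum>n. norm (x n * y n)) \<le> lp_norm q y * lp_norm p x"
  using assms(1-3)
proof (cases rule: conjugate_cases)
  case 1
  have le: "norm (x n * y n) \<le> lp_norm q y * norm (x n)" for n
    using mult_right_mono[OF lp_infinity_norm_le[of y n] norm_ge_zero[of "x n"]] y 1
    by (simp add: norm_mult mult.commute)
  have sx: "summable (\<lambda>n. norm (x n))"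
    using x 1 by (simp add: lp_def)
  then have sm: "summable (\<lambda>n. lp_norm q y * norm (x n))"
    by (rule summable_mult)
  have "summable (\<lambda>n. norm (x n * y n))"
    by (rule summable_comparison_test'[OF sm, of 0]) (use le in simp)
  moreover have "(\<Sum>n. norm (x n * y n)) \<le> (\<Sum>n. lp_norm q y * norm (x n))"
    by (rule suminf_le[OF le calculation sm])
  moreover have "\<dots> = lp_norm q y * lp_norm p x"
    using 1 sx suminf_mult[OF sx] suminf_nonneg[OF sx] by (simp add: lp_norm_def)
  ultimately show ?thesis
    by simp
next
  case (2 r s)
  then show ?thesis
    using lp_holder_real[of r s x y] x y by (simp add: lp_def lp_norm_def mult.commute)
qed

lemma lp_add:
  assumes "1 \<le> p" "u \<in> lp p" "v \<in> lp p"
  shows "(\<lambda>n. u n + v n) \<in> lp p"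
proof (cases "p = \<infinity>")
  case True
  then show ?thesis
    using assms bounded_plus_comp[of u UNIV v] by (auto simp: lp_def)
next
  case False
  define r where "r = enn2real p"
  have r: "0 < r"
    using assms(1) False by (auto simp: r_def enn2real_positive_iff less_top intro: less_le_trans[of 0 1])
  have le: "norm (u n + v n) powr r \<le> 2 powr r * (norm (u n) powr r + norm (v n) powr r)" for n
  proof -
    have "norm (u n + v n) powr r \<le> (2 * max (norm (u n)) (norm (v n))) powr r"
      using r norm_triangle_ineq[of "u n" "v n"] by (intro powr_mono2) auto
    also have "\<dots> = 2 powr r * max (norm (u n)) (norm (v n)) powr r"
      by (simp add: powr_mult)
    also have "\<dots> \<le> 2 powr r * (norm (u n) powr r + norm (v n) powr r)"
      by (intro mult_left_mono) (auto simp: max_def)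
    finally show ?thesis .
  qed
  have "summable (\<lambda>n. 2 powr r * (norm (u n) powr r + norm (v n) powr r))"
    using assms False by (intro summable_mult summable_add) (auto simp: lp_def r_def)
  then have "summable (\<lambda>n. norm (u n + v n) powr r)"
    by (rule summable_comparison_test'[of _ 0]) (use le in simp)
  then show ?thesis
    using assms False by (auto simp: lp_def r_def)
qed

lemma lp_scale:
  assumes "u \<in> lp p"
  shows "(\<lambda>n. c * u n) \<in> lp p"
proof (cases "p = \<infinity>")
  case True
  then obtain B where "\<And>n. norm (u n) \<le> B"
    using assms by (auto simp: lp_def bounded_iff)
  then have "norm (c * u n) \<le> norm c * B" for n
    by (simp add: norm_mult mult_left_mono)
  then have "bounded (range (\<lambda>n. c * u n))"
    by (auto simp: bounded_iff)
  then show ?thesis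
    using assms True by (simp add: lp_def)
next
  case False
  then show ?thesis
    using assms by (auto simp: lp_def norm_mult powr_mult intro!: summable_mult)
qed

lemma lp_pairing_in_dual:
  assumes "1 \<le> p" "p < \<infinity>" "1 / p + 1 / q = 1" and y: "y \<in> lp q"
  shows "lp_pairing p y \<in> lp_dual p"
proof -
  note holder = lp_holder[OF assms(1-3) _ y]
  have sm: "summable (\<lambda>n. x n * y n)" if "x \<in> lp p" for x
    using holder[OF that] by (auto intro: summable_norm_cancel)
  have app: "lp_pairing p y x = (\<Sum>n. x n * y n)" if "x \<in> lp p" for x
    using that by (simp add: lp_pairing_def)
  have "lp_pairing p y (\<lambda>n. u n + v n) = lp_pairing p y u + lp_pairing p y v"
    if "u \<in> lp p" "v \<in> lp p" for u v
    using suminf_add[OF sm[OF that(1)] sm[OF that(2)]]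
    by (simp add: app[OF that(1)] app[OF that(2)] app[OF lp_add[OF assms(1) that]] distrib_right)
  moreover have "lp_pairing p y (\<lambda>n. c * u n) = c * lp_pairing p y u" if "u \<in> lp p" for c u
    using suminf_mult[OF sm[OF that], of c]
    by (simp add: app[OF that] app[OF lp_scale[OF that]] mult.assoc)
  moreover have "norm (lp_pairing p y x) \<le> lp_norm q y * lp_norm p x" if "x \<in> lp p" for x
    using holder[OF that] summable_norm[of "\<lambda>n. x n * y n"] by (simp add: app[OF that])
  moreover have "lp_pairing p y \<in> extensional (lp p)"
    by (simp add: lp_pairing_def)
  ultimately show ?thesis
    unfolding lp_dual_def by blast
qed

lemma lp_finite_support:
  assumes "x 0 = 0" "finite A" "\<And>n. n \<notin> A \<Longrightarrow> x n = 0"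
  shows "x \<in> lp p"
proof -
  have "range x \<subseteq> insert 0 (x ` A)"
    using assms(3) by force
  then have "bounded (range x)"
    using assms(2) by (meson bounded_subset finite_imageI finite_imp_bounded finite_insert)
  moreover have "summable (\<lambda>n. norm (x n) powr enn2real p)"
    by (rule summable_finite[OF assms(2)]) (simp add: assms(3))
  ultimately show ?thesis
    using assms(1) by (simp add: lp_def)
qed

definition lp_unit :: "nat \<Rightarrow> nat \<Rightarrow> 'a::{real_normed_field,banach}" where
  "lp_unit k = (\<lambda>n. if n = k then 1 else 0)"

lemma lp_unit_in: "0 < k \<Longrightarrow> lp_unit k \<in> lp p"
  by (rule lp_finite_support[of _ "{k}"]) (auto simp: lp_unit_def)

lemma lp_norm_unit: "p < \<infinity> \<Longrightarrow> lp_norm p (lp_unit k) = 1"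
proof -
  assume "p < \<infinity>"
  moreover have "(\<lambda>n. norm (lp_unit k n :: 'a) powr enn2real p) = (\<lambda>n. if n = k then 1 else 0)"
    by (auto simp: lp_unit_def)
  moreover have "(\<Sum>n. if n = k then 1 else 0 :: real) = 1"
    using sums_unique[OF sums_single[of k "\<lambda>_. 1 :: real"]] by simp
  ultimately show ?thesis
    by (simp add: lp_norm_def)
qed

lemma lp_pairing_unit:
  "0 < k \<Longrightarrow> lp_pairing p y (lp_unit k) = y k"
proof -
  assume "0 < k"
  have "(\<lambda>n. lp_unit k n * y n) = (\<lambda>n. if n = k then y n else 0)"
    by (auto simp: lp_unit_def)
  then show ?thesis
    using \<open>0 < k\<close> sums_unique[OF sums_single[of k y]] by (simp add: lp_pairing_def lp_unit_in)
qed

lemma lp_dual_truncate: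
  assumes \<phi>: "\<phi> \<in> lp_dual p" and "x 0 = 0"
  shows "\<phi> (\<lambda>n. if n < N then x n else 0) = (\<Sum>n<N. x n * \<phi> (lp_unit n))"
proof -
  have add: "\<phi> (\<lambda>n. u n + v n) = \<phi> u + \<phi> v" if "u \<in> lp p" "v \<in> lp p" for u v
    using \<phi> that by (auto simp: lp_dual_def)
  have scale: "\<phi> (\<lambda>n. c * u n) = c * \<phi> u" if "u \<in> lp p" for c u
    using \<phi> that by (auto simp: lp_dual_def)
  have tr: "(\<lambda>n. if n < N then x n else 0) \<in> lp p" for N
    by (rule lp_finite_support[of _ "{..<N}"]) (use assms in auto)
  show ?thesis
  proof (induction N)
    case 0
    have "(\<lambda>n. 0) \<in> lp p"
      by (rule lp_finite_support[of _ "{}"]) auto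
    then have "\<phi> (\<lambda>n. 0 * 0) = 0 * \<phi> (\<lambda>n. 0)"
      by (rule scale)
    then show ?case
      by simp
  next
    case (Suc N)
    show ?case
    proof (cases "N = 0")
      case True
      have "(\<lambda>n. if n < Suc N then x n else 0) = (\<lambda>n. if n < N then x n else 0)"
        using True assms(2) by (auto simp: less_Suc_eq)
      then show ?thesis
        using Suc True assms(2) by simp
    next
      case False
      have "(\<lambda>n. if n < Suc N then x n else 0)
          = (\<lambda>n. (if n < N then x n else 0) + x N * lp_unit N n)"
        by (auto simp: lp_unit_def less_Suc_eq)
      then show ?thesis
        using Suc False by (simp add: add[OF tr lp_scale] lp_unit_in scale)
    qed
  qed
qed

lemma lp_dual_expand:
  assumes "1 \<le> p" "p < \<infinity>" and \<phi>: "\<phi> \<in> lp_dual p" and x: "x \<in> lp p"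
  shows "(\<lambda>n. x n * \<phi> (lp_unit n)) sums \<phi> x"
proof -
  define r where "r = enn2real p"
  have r: "0 < r"
    using assms(1,2) by (auto simp: r_def enn2real_positive_iff less_top intro: less_le_trans[of 0 1])
  have sx: "summable (\<lambda>n. norm (x n) powr r)" and x0: "x 0 = 0"
    using x assms by (auto simp: lp_def r_def)
  obtain C where C: "\<And>x. x \<in> lp p \<Longrightarrow> norm (\<phi> x) \<le> C * lp_norm p x"
    using \<phi> unfolding lp_dual_def by blast
  define h where "h N = (\<lambda>n. if n < N then x n else 0)" for N
  define t where "t N = (\<lambda>n. if n < N then 0 else x n)" for N
  have h: "h N \<in> lp p" for N
    unfolding h_def by (rule lp_finite_support[of _ "{..<N}"]) (use x0 in auto)
  have ts: "(\<lambda>n. norm (t N n) powr r) sums ((\<Sum>n. norm (x n) powr r) - (\<Sum>n<N. norm (x n) powr r))" for N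
  proof -
    have "(\<lambda>n. norm (x n) powr r - (if n < N then norm (x n) powr r else 0)) sums
        ((\<Sum>n. norm (x n) powr r) - (\<Sum>n<N. norm (x n) powr r))"
      using sums_If_finite_set[of "{..<N}" "\<lambda>n. norm (x n) powr r"]
      by (intro sums_diff summable_sums sx) simp
    moreover have "(\<lambda>n. norm (x n) powr r - (if n < N then norm (x n) powr r else 0))
        = (\<lambda>n. norm (t N n) powr r)"
      by (auto simp: t_def)
    ultimately show ?thesis
      by simp
  qed
  have t: "t N \<in> lp p" for N
    using sums_summable[OF ts[of N]] x0 assms(2) by (auto simp: lp_def r_def t_def)
  have nt: "lp_norm p (t N) = ((\<Sum>n. norm (x n) powr r) - (\<Sum>n<N. norm (x n) powr r)) powr (1 / r)" for N
    using sums_unique[OF ts[of N]] assms(2) by (auto simp: lp_norm_def r_def)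
  have "(\<lambda>N. (\<Sum>n. norm (x n) powr r) - (\<Sum>n<N. norm (x n) powr r))
      \<longlonglongrightarrow> (\<Sum>n. norm (x n) powr r) - (\<Sum>n. norm (x n) powr r)"
    by (intro tendsto_diff tendsto_const summable_LIMSEQ sx)
  moreover have "0 \<le> (\<Sum>n. norm (x n) powr r) - (\<Sum>n<N. norm (x n) powr r)" for N
    using sum_le_suminf[OF sx, of "{..<N}"] by simp
  ultimately have "(\<lambda>N. lp_norm p (t N)) \<longlonglongrightarrow> 0 powr (1 / r)"
    unfolding nt using r by (intro tendsto_powr2) auto
  then have lim: "(\<lambda>N. C * lp_norm p (t N)) \<longlonglongrightarrow> 0"
    by (auto intro: tendsto_mult_right_zero)
  have "(\<lambda>N. \<phi> x - (\<Sum>n<N. x n * \<phi> (lp_unit n))) \<longlonglongrightarrow> 0"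
  proof (rule Lim_null_comparison[OF _ lim], rule always_eventually, rule allI)
    fix N
    have "x = (\<lambda>n. h N n + t N n)"
      by (auto simp: h_def t_def)
    then have "\<phi> x = \<phi> (h N) + \<phi> (t N)"
      using \<phi> h t by (auto simp: lp_dual_def)
    moreover have "\<phi> (h N) = (\<Sum>n<N. x n * \<phi> (lp_unit n))"
      unfolding h_def using lp_dual_truncate[where x = x and N = N, OF \<phi> x0] by simp
    ultimately show "norm (\<phi> x - (\<Sum>n<N. x n * \<phi> (lp_unit n))) \<le> C * lp_norm p (t N)"
      using C[OF t] by simp
  qed
  then have "(\<lambda>N. \<phi> x - (\<phi> x - (\<Sum>n<N. x n * \<phi> (lp_unit n)))) \<longlonglongrightarrow> \<phi> x - 0"
    by (intro tendsto_diff tendsto_const)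
  then show ?thesis
    by (simp add: sums_def)
qed

lemma lp_dual_coefficients:
  fixes \<phi> :: "(nat \<Rightarrow> 'a::{real_normed_field,banach}) \<Rightarrow> 'a"
  assumes "1 \<le> p" "p < \<infinity>" "1 / p + 1 / q = 1" and \<phi>: "\<phi> \<in> lp_dual p"
  shows "(\<lambda>n. if n = 0 then 0 else \<phi> (lp_unit n)) \<in> lp q"
proof -
  define y where "y n = (if n = 0 then 0 else \<phi> (lp_unit n))" for n
  obtain C where C: "\<And>x. x \<in> lp p \<Longrightarrow> norm (\<phi> x) \<le> C * lp_norm p x"
    using \<phi> unfolding lp_dual_def by blast
  have "y \<in> lp q"
    using assms(1-3)
  proof (cases rule: conjugate_cases)
    case 1
    have "norm (y n) \<le> \<bar>C\<bar>" for n
      using C[OF lp_unit_in[of n]] lp_norm_unit[of p n, where 'a = 'a] assms(2) by (auto simp: y_def)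
    then show ?thesis
      using 1 unfolding lp_def bounded_iff by (auto simp: y_def[of 0])
  next
    case (2 r s)
    define x where "x n = (if y n = 0 then 0 else of_real (norm (y n) powr s) / y n)" for n
    have x0: "x 0 = 0"
      by (simp add: x_def y_def)
    have rs: "(s - 1) * r = s"
      using 2 by (simp add: field_simps)
    have nx: "norm (x n) powr r = norm (y n) powr s" for n
    proof (cases "y n = 0")
      case False
      then have "norm (x n) = norm (y n) powr (s - 1)"
        by (simp add: x_def norm_divide powr_diff)
      then show ?thesis
        by (simp only: powr_powr rs)
    qed (simp add: x_def)
    have xy: "x n * y n = of_real (norm (y n) powr s)" for n
      by (simp add: x_def)
    have bound: "(\<Sum>n<N. norm (y n) powr s) \<le> \<bar>C\<bar> powr s" for N
    proof -
      define S where "S = (\<Sum>n<N. norm (y n) powr s)"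
      have S: "0 \<le> S"
        unfolding S_def by (simp add: sum_nonneg)
      have tr: "(\<lambda>n. if n < N then x n else 0) \<in> lp p"
        by (rule lp_finite_support[of _ "{..<N}"]) (use x0 in auto)
      have "(\<lambda>n. norm (if n < N then x n else 0) powr r) = (\<lambda>n. if n \<in> {..<N} then norm (y n) powr s else 0)"
        by (auto simp: nx)
      then have "(\<Sum>n. norm (if n < N then x n else 0) powr r) = S"
        using sums_unique[OF sums_If_finite_set[of "{..<N}" "\<lambda>n. norm (y n) powr s"]]
        by (simp add: S_def)
      then have "lp_norm p (\<lambda>n. if n < N then x n else 0) = S powr (1 / r)"
        using 2 by (simp add: lp_norm_def)
      moreover have "\<phi> (\<lambda>n. if n < N then x n else 0) = of_real S"
      proof -
        have "x n * \<phi> (lp_unit n) = of_real (norm (y n) powr s)" for n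
          using xy[of n] x0 by (cases "n = 0") (auto simp: y_def)
        then show ?thesis
          using lp_dual_truncate[where x = x and N = N, OF \<phi> x0] by (simp add: S_def)
      qed
      ultimately have "S \<le> C * S powr (1 / r)"
        using C[OF tr] S by simp
      also have "\<dots> \<le> \<bar>C\<bar> * S powr (1 / r)"
        by (intro mult_right_mono) auto
      finally have le: "S \<le> \<bar>C\<bar> * S powr (1 / r)" .
      show ?thesis
      proof (cases "S = 0")
        case False
        then have "S powr (1 / s) * S powr (1 / r) = S"
          using S 2 by (simp flip: powr_add add: add.commute)
        then have "S powr (1 / s) \<le> \<bar>C\<bar>"
          using le False S by (metis mult_le_cancel_right not_less powr_gt_zero)
        then have "(S powr (1 / s)) powr s \<le> \<bar>C\<bar> powr s"
          using 2 by (intro powr_mono2) auto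
        then show ?thesis
          using S 2 by (simp add: powr_powr S_def)
      qed (simp add: S_def)
    qed
    have "summable (\<lambda>n. norm (y n) powr s)"
      by (rule summableI_nonneg_bounded[OF _ bound]) simp
    then show ?thesis
      using 2 by (simp add: lp_def y_def)
  qed
  then show ?thesis
    unfolding y_def .
qed

theorem bij_betw_lp_pairing:
  assumes "1 \<le> p" "p < \<infinity>" "1 / p + 1 / q = 1"
  shows "bij_betw (lp_pairing p)
    (lp q :: (nat \<Rightarrow> 'a::{real_normed_field,banach}) set) (lp_dual p)"
proof (rule bij_betw_imageI)
  show "inj_on (lp_pairing p) (lp q :: (nat \<Rightarrow> 'a) set)"
  proof (intro inj_onI ext)
    fix y z :: "nat \<Rightarrow> 'a" and k
    assume "y \<in> lp q" "z \<in> lp q" "lp_pairing p y = lp_pairing p z"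
    then show "y k = z k"
      using lp_pairing_unit[of k p y] lp_pairing_unit[of k p z] by (cases "k = 0") (auto simp: lp_def)
  qed
  have "\<phi> \<in> lp_pairing p ` lp q" if \<phi>: "\<phi> \<in> lp_dual p" for \<phi> :: "(nat \<Rightarrow> 'a) \<Rightarrow> 'a"
  proof (rule image_eqI)
    let ?y = "\<lambda>n. if n = 0 then 0 else \<phi> (lp_unit n)"
    show "?y \<in> lp q"
      by (rule lp_dual_coefficients[OF assms \<phi>])
    have "\<phi> x = (\<Sum>n. x n * ?y n)" if "x \<in> lp p" for x
    proof -
      have "(\<lambda>n. x n * ?y n) = (\<lambda>n. x n * \<phi> (lp_unit n))"
        using that by (auto simp: lp_def)
      then show ?thesis
        using sums_unique[OF lp_dual_expand[OF assms(1,2) \<phi> that]] by simp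
    qed
    then show "\<phi> = lp_pairing p ?y"
      using \<phi> by (intro extensionalityI[of _ "lp p"]) (auto simp: lp_dual_def lp_pairing_def)
  qed
  moreover have "lp_pairing p y \<in> lp_dual p" if "y \<in> lp q" for y :: "nat \<Rightarrow> 'a"
    by (rule lp_pairing_in_dual[OF assms that])
  ultimately show "lp_pairing p ` (lp q :: (nat \<Rightarrow> 'a) set) = lp_dual p"
    by blast
qed

end

theory Submission
  imports Defs
begin

text \<open>
  Both operators come from the map \<^const>\<open>collatz\<close>: the backward operator composes a sequence with
  it, the forward operator sums a sequence over its fibres.

  Summing \<open>x n * y (collatz n)\<close> fibre by fibre (\<open>collatz_forward_sums\<close>) moves the map from one
  factor to the other, so the two operators are adjoint for the pairing of \<^term>\<open>lp p\<close> with
  \<^term>\<open>lp q\<close> (\<open>lp_pairing_collatz_forward\<close>). Since that pairing identifies \<^term>\<open>lp q\<close> with the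
  dual of \<^term>\<open>lp p\<close>, this adjointness is the assertion on dual operators.

  Both operators are bounded because fibres have at most two elements: a positive \<open>m\<close> is always
  hit by the even number \<open>2 * m\<close>, and it is hit by one odd number as well exactly when
  \<open>m mod 3 = 2\<close>. For the backward operator the exact count (\<open>collatz_backward_sums\<close>) shows that the
  \<open>p\<close>-th power of the norm at most doubles. It does double on the unit sequence at \<open>2\<close>, which is
  sent to the indicator of the two preimages \<open>1\<close> and \<open>4\<close>; hence the norm is \<open>2 powr (1 / p)\<close>. For
  \<open>p = \<infinity>\<close> composition does not increase the supremum norm, and the same sequence shows that the
  norm is \<open>1\<close>.
\<close>

section \<open>Finite exponents as real numbers\<close>

lemma enn2real_inverse_exponent:
  assumes "1 \<le> p" "p \<noteq> \<infinity>"
  shows "0 < enn2real p \<and> enn2real (1 / p) = 1 / enn2real p"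
proof -
  obtain r where r: "p = ennreal r" "0 \<le> r"
    using assms(2) by (cases p) auto
  have "1 \<le> r"
    using assms(1) r by simp
  moreover from this have "ennreal 1 / ennreal r = ennreal (1 / r)"
    by (intro divide_ennreal) auto
  ultimately show ?thesis
    using r by simp
qed

lemma conjugate_ge_1:
  assumes "1 \<le> p" "p < \<infinity>" "1 / p + 1 / q = (1::ennreal)"
  shows "1 \<le> q"
  using assms by (cases rule: conjugate_cases) auto

lemma conjugate_2_2: "1 / 2 + 1 / 2 = (1 :: ennreal)"
proof -
  have "(1 :: ennreal) / 2 = ennreal 1 / ennreal 2"
    by simp
  also have "\<dots> = ennreal (1 / 2)"
    by (rule divide_ennreal) auto
  finally have "(1 :: ennreal) / 2 + 1 / 2 = ennreal (1 / 2) + ennreal (1 / 2)"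
    by (simp only:)
  also have "\<dots> = ennreal (1 / 2 + 1 / 2)"
    by (rule ennreal_plus[symmetric]) auto
  finally show ?thesis
    by simp
qed

section \<open>The fibres of the Collatz map\<close>

lemma collatz_0 [simp]: "collatz 0 = 0"
  by (simp add: collatz_def)

lemma collatz_eq_0_iff [simp]: "collatz n = 0 \<longleftrightarrow> n = 0"
  unfolding collatz_def by presburger

lemma collatz_fibre_subset: "{n. n \<ge> 1 \<and> collatz n = m} \<subseteq> {2 * m, (2 * m - 1) div 3}"
proof
  fix n
  assume "n \<in> {n. n \<ge> 1 \<and> collatz n = m}"
  then have m: "m = (if even n then n div 2 else (3 * n + 1) div 2)"
    by (simp add: collatz_def)
  show "n \<in> {2 * m, (2 * m - 1) div 3}"
  proof (cases "even n")
    case True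
    then have "n = 2 * m"
      using m by auto
    then show ?thesis
      by simp
  next
    case False
    then have "3 * n + 1 = 2 * m"
      using m by auto
    then have "2 * m - 1 = n * 3"
      by simp
    then show ?thesis
      by simp
  qed
qed

lemma card_collatz_fibre: "card {n. n \<ge> 1 \<and> collatz n = m} \<le> 2"
proof -
  have "card {n. n \<ge> 1 \<and> collatz n = m} \<le> card {2 * m, (2 * m - 1) div 3}"
    by (rule card_mono[OF _ collatz_fibre_subset]) simp
  also have "\<dots> \<le> 2"
    by (simp add: card_insert_if)
  finally show ?thesis .
qed

lemma collatz_fibre_0: "{n. n \<ge> 1 \<and> collatz n = 0} = {}"
  by auto

lemma collatz_eq_2_iff: "collatz n = 2 \<longleftrightarrow> n = 1 \<or> n = 4"
proof
  assume n: "collatz n = 2"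
  then have "n \<ge> 1"
    by (cases n) auto
  then show "n = 1 \<or> n = 4"
    using collatz_fibre_subset[of 2] n by auto
qed (auto simp: collatz_def)

lemma collatz_forward_0 [simp]: "collatz_forward x 0 = 0"
  unfolding collatz_forward_def collatz_fibre_0 by simp

section \<open>Summation along the Collatz map\<close>

text \<open>
  Absolute convergence allows the terms to be grouped by the value of \<^const>\<open>collatz\<close>; the term at
  index \<open>0\<close> has to vanish because fibres only contain positive integers.
\<close>

lemma collatz_forward_sums:
  fixes f :: "nat \<Rightarrow> 'a::{real_normed_field,banach}"
  assumes "summable (\<lambda>n. norm (f n))" "f 0 = 0"
  shows "collatz_forward f sums (\<Sum>n. f n)"
proof -
  define F where "F m = {n. n \<ge> 1 \<and> collatz n = m}" for m
  have "f sums (\<Sum>n. f n)"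
    by (rule summable_sums[OF summable_norm_cancel[OF assms(1)]])
  then have "(f has_sum (\<Sum>n. f n)) UNIV"
    by (rule norm_summable_imp_has_sum[OF assms(1)])
  also have "?this \<longleftrightarrow> (f has_sum (\<Sum>n. f n)) {1..}"
    using assms(2) by (intro has_sum_cong_neutral) (auto simp: not_le)
  also have "\<dots> \<longleftrightarrow> ((\<lambda>(m, n). f n) has_sum (\<Sum>n. f n)) (Sigma UNIV F)"
    by (rule has_sum_reindex_bij_witness[of _ snd "\<lambda>n. (collatz n, n)"]) (auto simp: F_def)
  finally have "((\<lambda>m. \<Sum>n\<in>F m. f n) has_sum (\<Sum>n. f n)) UNIV"
    by (rule has_sum_SigmaD) (simp add: F_def finite_collatz_fibre[simplified])
  then show ?thesis
    by (intro has_sum_imp_sums) (simp add: F_def collatz_forward_def[abs_def])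
qed

text \<open>
  The first sum on the right collects the even arguments and the second the odd ones, because
  \<open>collatz (2 * m) = m\<close> and \<open>collatz (2 * k + 1) = 3 * k + 2\<close>.
\<close>

lemma collatz_backward_sums:
  fixes g :: "nat \<Rightarrow> real"
  assumes "summable g" "\<And>n. 0 \<le> g n"
  shows "(\<lambda>n. g (collatz n)) sums ((\<Sum>k. g (3 * k + 2)) + (\<Sum>m. g m))"
proof -
  have "summable (g \<circ> (\<lambda>k. 3 * k + 2))"
    using assms by (intro summable_reindex) (auto simp: inj_def)
  then have "(\<lambda>k. g (3 * k + 2)) sums (\<Sum>k. g (3 * k + 2))"
    by (simp add: o_def summable_sums)
  from sums_if[OF this summable_sums[OF assms(1)]]
  have "(\<lambda>n. if even n then g (n div 2) else g (3 * ((n - 1) div 2) + 2))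
      sums ((\<Sum>k. g (3 * k + 2)) + (\<Sum>m. g m))" .
  moreover have "3 * ((n - 1) div 2) + 2 = (3 * n + 1) div 2" if "odd n" for n :: nat
    using that by (elim oddE) simp
  then have "(if even n then g (n div 2) else g (3 * ((n - 1) div 2) + 2)) = g (collatz n)" for n
    by (simp add: collatz_def)
  ultimately show ?thesis
    by simp
qed

section \<open>Boundedness of the forward operator\<close>

text \<open>
  A sum of at most two terms is at most twice the largest term in norm, and the \<open>r\<close>-th power of
  that term is one of the nonnegative terms on the right.
\<close>

lemma norm_collatz_forward_powr_le:
  fixes x :: "nat \<Rightarrow> 'a::real_normed_vector"
  assumes "0 < r"
  shows "norm (collatz_forward x m) powr r
    \<le> 2 powr r * collatz_forward (\<lambda>n. norm (x n) powr r) m"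
proof (cases "m = 0")
  case True
  then show ?thesis
    by simp
next
  case False
  define F where "F = {n. n \<ge> 1 \<and> collatz n = m}"
  have F: "finite F" "card F \<le> 2"
    unfolding F_def using finite_collatz_fibre card_collatz_fibre by blast+
  have "2 * m \<in> F"
    using False by (simp add: F_def collatz_def)
  then have "Max ((\<lambda>n. norm (x n)) ` F) \<in> (\<lambda>n. norm (x n)) ` F"
    using F(1) by (intro Max_in) auto
  then obtain k where k: "k \<in> F" "Max ((\<lambda>n. norm (x n)) ` F) = norm (x k)"
    by blast
  have le: "norm (x n) \<le> norm (x k)" if "n \<in> F" for n
    using F(1) that unfolding k(2)[symmetric] by (intro Max_ge) auto
  have "norm (sum x F) \<le> (\<Sum>n\<in>F. norm (x n))"
    by (rule norm_sum)
  also have "\<dots> \<le> of_nat (card F) * norm (x k)"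
    by (rule sum_bounded_above) (rule le)
  also have "\<dots> \<le> 2 * norm (x k)"
    using F(2) by (intro mult_right_mono) auto
  finally have "norm (sum x F) powr r \<le> (2 * norm (x k)) powr r"
    using assms by (intro powr_mono2) auto
  also have "\<dots> = 2 powr r * norm (x k) powr r"
    by (simp add: powr_mult)
  also have "\<dots> \<le> 2 powr r * (\<Sum>n\<in>F. norm (x n) powr r)"
    using F(1) k(1) by (intro mult_left_mono member_le_sum) auto
  finally show ?thesis
    by (simp add: collatz_forward_def F_def)
qed

lemma collatz_forward_bounded:
  fixes x :: "nat \<Rightarrow> 'a::{real_normed_field,banach}"
  assumes "1 \<le> p" "p < \<infinity>" and x: "x \<in> lp p"
  shows "collatz_forward x \<in> lp p \<and> lp_norm p (collatz_forward x) \<le> 2 * lp_norm p x"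
proof -
  define r where "r = enn2real p"
  have r: "0 < r"
    using enn2real_inverse_exponent[of p] assms(1,2) by (simp add: r_def)
  define S where "S = (\<Sum>n. norm (x n) powr r)"
  have sx: "summable (\<lambda>n. norm (x n) powr r)" and x0: "x 0 = 0"
    using x assms(2) by (auto simp: lp_def r_def)
  have S: "0 \<le> S"
    unfolding S_def using sx by (rule suminf_nonneg) simp
  have "collatz_forward (\<lambda>n. norm (x n) powr r) sums S"
    unfolding S_def by (rule collatz_forward_sums) (use sx x0 in auto)
  then have sm: "(\<lambda>m. 2 powr r * collatz_forward (\<lambda>n. norm (x n) powr r) m) sums (2 powr r * S)"
    by (rule sums_mult)
  have sL: "summable (\<lambda>m. norm (collatz_forward x m) powr r)"
    by (rule summable_comparison_test'[OF sums_summable[OF sm], of 0])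
      (simp add: norm_collatz_forward_powr_le[OF r])
  have "(\<Sum>m. norm (collatz_forward x m) powr r) \<le> 2 powr r * S"
    using suminf_le[OF norm_collatz_forward_powr_le[OF r] sL sums_summable[OF sm]] sums_unique[OF sm]
    by simp
  then have "(\<Sum>m. norm (collatz_forward x m) powr r) powr (1 / r) \<le> (2 powr r * S) powr (1 / r)"
    using r suminf_nonneg[OF sL] by (intro powr_mono2) auto
  also have "\<dots> = 2 * S powr (1 / r)"
    using r S by (simp add: powr_mult powr_powr)
  finally show ?thesis
    using sL less_imp_neq[OF assms(2)] by (simp add: lp_def lp_norm_def r_def S_def)
qed

lemma lp_bounded_operator_collatz_forward:
  assumes "1 \<le> p" "p < \<infinity>"
  shows "lp_bounded_operator p
    (collatz_forward :: (nat \<Rightarrow> 'a::{real_normed_field,banach}) \<Rightarrow> nat \<Rightarrow> 'a)"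
  unfolding lp_bounded_operator_def
  using collatz_forward_bounded[OF assms, where 'a = 'a]
  by (auto simp: collatz_forward_def fun_eq_iff sum.distrib sum_distrib_left)

section \<open>The norm of the backward operator\<close>

text \<open>
  For finite \<open>p\<close> the factor \<open>2\<close> under the root is the sum of two ones: the even arguments contribute
  the whole series of \<open>norm (x m) powr p\<close>, the odd ones its subseries over \<open>m = 3 * k + 2\<close>.
\<close>

lemma collatz_backward_bounded:
  fixes x :: "nat \<Rightarrow> 'a::{real_normed_field,banach}"
  assumes "1 \<le> p" and x: "x \<in> lp p"
  shows "collatz_backward x \<in> lp p \<and>
    lp_norm p (collatz_backward x) \<le> 2 powr enn2real (1 / p) * lp_norm p x"
proof (cases "p = \<infinity>")
  case True
  have "range (collatz_backward x) \<subseteq> range x"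
    by (auto simp: collatz_backward_eq)
  then have "collatz_backward x \<in> lp p"
    using x True by (auto simp: lp_def collatz_backward_eq intro: bounded_subset)
  moreover have "(SUP n. norm (collatz_backward x n)) \<le> lp_norm \<infinity> x"
    using lp_infinity_norm_le[of x] x True
    by (intro cSUP_least) (auto simp: collatz_backward_eq)
  ultimately show ?thesis
    using True by (simp add: lp_norm_def)
next
  case False
  define r where "r = enn2real p"
  have r: "0 < r" and ip: "enn2real (1 / p) = 1 / r"
    using enn2real_inverse_exponent[OF assms(1) False] by (simp_all add: r_def)
  define g where "g n = norm (x n) powr r" for n
  have sg: "summable g" and x0: "x 0 = 0" and g: "\<And>n. 0 \<le> g n"
    using x False by (simp_all add: lp_def r_def g_def[abs_def])
  note sm = collatz_backward_sums[OF sg g]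
  have "(\<Sum>k. g (3 * k + 2)) \<le> (\<Sum>m. g m)"
    using suminf_reindex_mono[OF sg, of "\<lambda>k. 3 * k + 2"] g by (auto simp: inj_def o_def)
  then have "(\<Sum>n. g (collatz n)) \<le> 2 * (\<Sum>m. g m)"
    using sums_unique[OF sm] by simp
  then have "(\<Sum>n. g (collatz n)) powr (1 / r) \<le> (2 * (\<Sum>m. g m)) powr (1 / r)"
    using r g suminf_nonneg[OF sums_summable[OF sm]] by (intro powr_mono2) auto
  also have "\<dots> = 2 powr (1 / r) * (\<Sum>m. g m) powr (1 / r)"
    using suminf_nonneg[OF sg g] by (simp add: powr_mult)
  finally show ?thesis
    using False sums_summable[OF sm] x0
    by (simp add: lp_def lp_norm_def collatz_backward_eq ip flip: r_def g_def)
qed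

lemma lp_bounded_operator_collatz_backward:
  assumes "1 \<le> p"
  shows "lp_bounded_operator p
    (collatz_backward :: (nat \<Rightarrow> 'a::{real_normed_field,banach}) \<Rightarrow> nat \<Rightarrow> 'a)"
  unfolding lp_bounded_operator_def
  using collatz_backward_bounded[OF assms, where 'a = 'a]
  by (auto simp: collatz_backward_eq fun_eq_iff)

text \<open>
  For \<open>p = \<infinity>\<close> the exponent on the right is \<open>0\<close>, and the power is \<open>1\<close> because \<open>A\<close> is nonempty.
\<close>

lemma lp_norm_indicator:
  assumes "1 \<le> p" "finite A" "A \<noteq> {}"
  shows "lp_norm p (\<lambda>n. if n \<in> A then 1 else 0 :: 'a::{real_normed_field,banach})
    = real (card A) powr enn2real (1 / p)"
proof (cases "p = \<infinity>")
  case True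
  have "(SUP n. norm (if n \<in> A then 1 else 0 :: 'a)) = 1"
    using assms(3) by (intro cSup_eq_maximum) (auto simp: image_iff split: if_splits)
  then show ?thesis
    using True assms by (simp add: lp_norm_def)
next
  case False
  define r where "r = enn2real p"
  have r: "0 < r" and ip: "enn2real (1 / p) = 1 / r"
    using enn2real_inverse_exponent[OF assms(1) False] by (simp_all add: r_def)
  have "(\<lambda>n. norm (if n \<in> A then 1 else 0 :: 'a) powr r) = (\<lambda>n. if n \<in> A then 1 else 0)"
    by auto
  then have "(\<Sum>n. norm (if n \<in> A then 1 else 0 :: 'a) powr r) = real (card A)"
    using sums_unique[OF sums_If_finite_set[OF assms(2), of "\<lambda>_. 1 :: real"]] by simp
  then show ?thesis
    using False by (simp add: lp_norm_def ip flip: r_def)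
qed

lemma lp_onorm_collatz_backward:
  assumes "1 \<le> p"
  shows "lp_onorm p (collatz_backward :: (nat \<Rightarrow> 'a::{real_normed_field,banach}) \<Rightarrow> nat \<Rightarrow> 'a)
    = 2 powr enn2real (1 / p)"
  unfolding lp_onorm_def
proof (rule cSup_eq_maximum)
  \<comment> \<open>\<open>2\<close> is the least positive integer with two preimages.\<close>
  let ?e = "lp_unit 2 :: nat \<Rightarrow> 'a"
  have "?e = (\<lambda>n. if n \<in> {2} then 1 else 0)"
    by (simp add: lp_unit_def)
  then have "lp_norm p ?e = 1"
    using lp_norm_indicator[OF assms, of "{2}", where 'a = 'a] by simp
  moreover have "?e \<in> lp p"
    by (rule lp_unit_in) simp
  moreover have "collatz_backward ?e = (\<lambda>n. if n \<in> {1, 4} then 1 else 0)"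
    by (auto simp: fun_eq_iff collatz_backward_eq lp_unit_def collatz_eq_2_iff)
  then have "lp_norm p (collatz_backward ?e) = 2 powr enn2real (1 / p)"
    using lp_norm_indicator[OF assms, of "{1, 4}", where 'a = 'a] by simp
  ultimately show "2 powr enn2real (1 / p)
      \<in> (\<lambda>x. lp_norm p (collatz_backward x)) ` {x \<in> lp p. lp_norm p (x :: nat \<Rightarrow> 'a) \<le> 1}"
    by (intro image_eqI[of _ _ ?e]) auto
next
  fix t
  assume "t \<in> (\<lambda>x. lp_norm p (collatz_backward x)) ` {x \<in> lp p. lp_norm p (x :: nat \<Rightarrow> 'a) \<le> 1}"
  then obtain x :: "nat \<Rightarrow> 'a"
    where x: "x \<in> lp p" "lp_norm p x \<le> 1" "t = lp_norm p (collatz_backward x)"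
    by blast
  have "t \<le> 2 powr enn2real (1 / p) * lp_norm p x"
    using collatz_backward_bounded[OF assms x(1)] x(3) by simp
  also have "\<dots> \<le> 2 powr enn2real (1 / p) * 1"
    using x(2) by (intro mult_left_mono) auto
  finally show "t \<le> 2 powr enn2real (1 / p)"
    by simp
qed

section \<open>Duality of the two operators\<close>

text \<open>
  The factor \<open>y (collatz n)\<close> is constant on fibres, so summing \<open>x n * y (collatz n)\<close> over the fibre
  of \<open>m\<close> gives \<open>collatz_forward x m * y m\<close>. The inequality of Hoelder supplies the absolute
  convergence under which the terms may be grouped in this way.
\<close>

lemma lp_pairing_collatz_forward:
  fixes x y :: "nat \<Rightarrow> 'a::{real_normed_field,banach}"
  assumes "1 \<le> p" "p < \<infinity>" "1 / p + 1 / q = 1" and x: "x \<in> lp p" and y: "y \<in> lp q"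
  shows "lp_pairing p y (collatz_forward x) = lp_pairing p (collatz_backward y) x"
proof -
  have By: "collatz_backward y \<in> lp q"
    using collatz_backward_bounded[OF conjugate_ge_1[OF assms(1-3)] y] by blast
  have "collatz_forward (\<lambda>n. x n * collatz_backward y n) sums (\<Sum>n. x n * collatz_backward y n)"
    using lp_holder[OF assms(1-3) x By] x by (intro collatz_forward_sums) (auto simp: lp_def)
  moreover have "collatz_forward (\<lambda>n. x n * collatz_backward y n) = (\<lambda>m. collatz_forward x m * y m)"
    by (auto simp: fun_eq_iff collatz_forward_def collatz_backward_eq sum_distrib_right
        intro!: sum.cong)
  ultimately show ?thesis
    using x collatz_forward_bounded[OF assms(1,2) x] by (simp add: lp_pairing_def sums_iff)
qed

lemma lp_dual_operator_collatz_forward: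
  fixes y :: "nat \<Rightarrow> 'a::{real_normed_field,banach}"
  assumes "1 \<le> p" "p < \<infinity>" "1 / p + 1 / q = 1" and y: "y \<in> lp q"
  shows "lp_dual_operator p q collatz_forward y = collatz_backward y"
proof -
  have "compose (lp p) (lp_pairing p y) collatz_forward = lp_pairing p (collatz_backward y)"
    by (rule extensionalityI[of _ "lp p"])
      (auto simp: compose_def lp_pairing_collatz_forward[OF assms(1-3) _ y], simp add: lp_pairing_def)
  moreover have "collatz_backward y \<in> lp q"
    using collatz_backward_bounded[OF conjugate_ge_1[OF assms(1-3)] y] by blast
  ultimately show ?thesis
    using bij_betw_imp_inj_on[OF bij_betw_lp_pairing[OF assms(1-3), where 'a = 'a]]
    by (simp add: lp_dual_operator_def the_inv_into_f_f)
qed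

theorem theorem4p3:
  shows "(\<forall>p q. 1 \<le> p \<and> p < \<infinity> \<and> 1 / p + 1 / q = 1 \<longrightarrow>
            lp_bounded_operator p (collatz_forward :: (nat \<Rightarrow> 'a::{real_normed_field,banach}) \<Rightarrow> nat \<Rightarrow> 'a) \<and>
            (\<forall>y\<in>lp q. lp_dual_operator p q collatz_forward y = (collatz_backward y :: nat \<Rightarrow> 'a))) \<and>
         (\<forall>y\<in>lp 2. lp_dual_operator 2 2 collatz_forward y = (collatz_backward y :: nat \<Rightarrow> 'a)) \<and>
         (\<forall>p\<ge>1. lp_bounded_operator p (collatz_backward :: (nat \<Rightarrow> 'a) \<Rightarrow> nat \<Rightarrow> 'a) \<and>
            lp_onorm p (collatz_backward :: (nat \<Rightarrow> 'a) \<Rightarrow> nat \<Rightarrow> 'a) = 2 powr enn2real (1 / p))"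
proof (intro conjI allI impI ballI)
  fix y :: "nat \<Rightarrow> 'a"
  assume "y \<in> lp 2"
  then show "lp_dual_operator 2 2 collatz_forward y = collatz_backward y"
    by (intro lp_dual_operator_collatz_forward conjugate_2_2) auto
qed (blast intro: lp_bounded_operator_collatz_forward lp_dual_operator_collatz_forward
    lp_bounded_operator_collatz_backward lp_onorm_collatz_backward)+

end
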